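(* Let $\mathfrak g$ be of type $A_2$ ($c_1=c_2=1$). (i) If $\dfrac{\lambda_1}{-\lambda_2}>1$, then $H_{-1}$ is the highest weight vector and $L_2$ is the lowest weight vector of $B_0(\lambda)$. (ii) If $\dfrac{\lambda_1}{-\lambda_2}=1$, then $H_{-1}$ is the highest weight vector and $L_1$ is the lowest weight vector of $B_0(\lambda)$. (iii) If $1>\dfrac{\lambda_1}{-\lambda_2}>0$, then $H_{-2}$ is the highest weight vector and $L_1$ is the lowest weight vector of $B_0(\lambda)$.
   Context: Setting. $\mathfrak g$ has rank 2, $I=\{1,2\}$, with simple roots $\alpha_i$, simple coroots $h_i$ and Cartan matrix $\langle h_1,\alpha_1\rangle=\langle h_2,\alpha_2\rangle=2$, $\langle h_1,\alpha_2\rangle=-c_1$, $\langle h_2,\alpha_1\rangle=-c_2$; here $c_1=c_2=1$. Let $\lambda=\lambda_1\Lambda_1+\lambda_2\Lambda_2$ with $\Lambda_i$ the fundamental weights (so $\langle h_i,\lambda\rangle=\lambda_i$), $\lambda_1\in\mathbb Z_{>0}$, $\lambda_2\in\mathbb Z_{<0}$. The crystal $\mathbb Z^\infty_\iota[\lambda]$. Fix $\iota=(\dots,i_2,i_1,t_\lambda,i_{-1},i_{-2},\dots)=(\dots,1,2,1,t_\lambda,2,1,2,\dots)$, i.e. $i_k=1$ for $k>0$ odd, $i_k=2$ for $k>0$ even, $i_{-k}=2$ for $k>0$ odd, $i_{-k}=1$ for $k>0$ even. As a set, $\mathbb Z^\infty_\iota[\lambda]$ consists of the sequences $\vec x=(\dots,x_2,x_1,t_\lambda,x_{-1},x_{-2},\dots)$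 with $x_k\in\mathbb Z$ ($k\in\mathbb Z\setminus\{0\}$), all but finitely many zero ($t_\lambda$ is a formal symbol). There is no coordinate $x_0$; sums run over nonzero indices. Put $\sigma_k(\vec x)=x_k+\sum_{j>k}\langle h_{i_k},\alpha_{i_j}\rangle x_j$ for $k\ge1$ and $\sigma_k(\vec x)=-\langle h_{i_k},\lambda\rangle+x_k+\sum_{j>k}\langle h_{i_k},\alpha_{i_j}\rangle x_j$ for $k\le -1$. Let $\sigma^{(i)}(\vec x)=\max_{k:\,i_k=i}\sigma_k(\vec x)$ and $M^{(i)}=\{k: i_k=i,\ \sigma_k(\vec x)=\sigma^{(i)}(\vec x)\}$. The crystal operators are: $\tilde e_i\vec x$ is obtained from $\vec x$ by decreasing $x_{\max M^{(i)}}$ by 1 if $\max M^{(i)}$ exists, and $\tilde e_i\vec x=0$ otherwise; $\tilde f_i\vec x$ is obtained from $\vec x$ by increasing $x_{\min M^{(i)}}$ by 1 if $\min M^{(i)}$ exists, and $\tilde f_i\vec x=0$ otherwise. Also $wt(\vec x)=\lambda-\sum_j x_j\alpha_{i_j}$, $\varepsilon_i(\vec x)=\sigma^{(i)}(\vec x)$, $\varphi_i(\vec x)=\langle h_i,wt(\vec x)\rangle+\varepsilon_i(\vec x)$. $B_0(\lambda)$. The crystal $B(U_q(\mathfrak g)a_\lambda)\cong B(\infty)\otimes T_\lambda\otimes B(-\infty)$ of the modified quantum algebra is identified with its image under the unique strict embedding into $\mathbb Z^\infty_\iota[\lambda]$ sending $u_\infty\otimes t_\lambda\otimes u_{-\infty}$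 to $(\dots,0,0,t_\lambda,0,0,\dots)$. $B_0(\lambda)$ is its connected component containing $u_\infty\otimes t_\lambda\otimes u_{-\infty}$; equivalently, the connected component of $(\dots,0,0,t_\lambda,0,0,\dots)$ in $\mathbb Z^\infty_\iota[\lambda]$. A highest (resp. lowest) weight vector of a crystal is an element $b$ with $\tilde e_ib=0$ (resp. $\tilde f_ib=0$) for all $i\in I$. The vectors. With $a_0=a'_0=0$, $a_l=a'_l$ and $a_1=1,a_2=1,a_3=0$: $h_{-1}=a'_0\lambda_1+a'_1\lambda_2=\lambda_2$, $h_{-2}=a_1\lambda_1+a_2\lambda_2=\lambda_1+\lambda_2$, $l_1=a_1\lambda_1+a_0\lambda_2=\lambda_1$, $l_2=a'_2\lambda_1+a'_1\lambda_2=\lambda_1+\lambda_2$, $H_{-j}=(\dots,0,0,t_\lambda,h_{-1},\dots,h_{-j},0,0,\dots)$ and $L_j=(\dots,0,0,l_j,\dots,l_1,t_\lambda,0,0,\dots)$. *)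

theory Defs
  imports Complex_Main
begin

text \<open>
  Rank-two data: the index set is \<open>{1, 2}\<close>; a weight \<open>\<lambda> = \<lambda>\<^sub>1 \<Lambda>\<^sub>1 + \<lambda>\<^sub>2 \<Lambda>\<^sub>2\<close> is given by
  its two coordinates.
\<close>

definition index_set :: "nat set" where
  "index_set = {1, 2}"

definition cartan :: "int \<Rightarrow> int \<Rightarrow> nat \<Rightarrow> nat \<Rightarrow> int" where
  "cartan c1 c2 i j = (if i = j then 2 else if i = 1 then - c1 else - c2)"

definition weight_pairing :: "int \<Rightarrow> int \<Rightarrow> nat \<Rightarrow> int" where
  "weight_pairing lam1 lam2 i = (if i = 1 then lam1 else lam2)"

text \<open>The sequence \<open>\<dots>, 2, 1, 2, 1, t\<^sub>\<lambda>, 2, 1, 2, 1, \<dots>\<close>; the value at \<open>0\<close> is irrelevant.\<close>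

definition iota :: "int \<Rightarrow> nat" where
  "iota k = (if k > 0 then (if odd k then 1 else 2) else (if odd k then 2 else 1))"

text \<open>
  A sequence \<open>(\<dots>, x\<^sub>2, x\<^sub>1, t\<^sub>\<lambda>, x\<^sub>-\<^sub>1, x\<^sub>-\<^sub>2, \<dots>)\<close> is a function on the integers. There is no
  coordinate at position \<open>0\<close> (the place of the formal symbol \<open>t\<^sub>\<lambda>\<close>): its value is normalised
  to \<open>0\<close>, and \<open>0\<close> is excluded from all index ranges below.
\<close>

definition Zinf :: "(int \<Rightarrow> int) set" where
  "Zinf = {x. x 0 = 0 \<and> finite {k. x k \<noteq> 0}}"

text \<open>
  The sum is restricted to the support of \<open>x\<close> so that it is finite.
\<close>

definition sigma :: "int \<Rightarrow> int \<Rightarrow> int \<Rightarrow> int \<Rightarrow> (int \<Rightarrow> int) \<Rightarrow> int \<Rightarrow> int" where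
  "sigma c1 c2 lam1 lam2 x k =
     (if k < 0 then - weight_pairing lam1 lam2 (iota k) else 0) + x k +
     (\<Sum>j | j > k \<and> j \<noteq> 0 \<and> x j \<noteq> 0. cartan c1 c2 (iota k) (iota j) * x j)"

text \<open>
  For \<open>x\<close> in \<^const>\<open>Zinf\<close> and \<open>i\<close> in \<^const>\<open>index_set\<close> the set below is finite and nonempty,
  since \<open>\<sigma>\<^sub>k(x)\<close> is constant in \<open>k\<close> (among \<open>k\<close> with \<open>i\<^sub>k = i\<close>) to the left and to the right of
  the support of \<open>x\<close>.
\<close>

definition sigma_max :: "int \<Rightarrow> int \<Rightarrow> int \<Rightarrow> int \<Rightarrow> nat \<Rightarrow> (int \<Rightarrow> int) \<Rightarrow> int" where
  "sigma_max c1 c2 lam1 lam2 i x = Max {sigma c1 c2 lam1 lam2 x k | k. k \<noteq> 0 \<and> iota k = i}"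

definition Mset :: "int \<Rightarrow> int \<Rightarrow> int \<Rightarrow> int \<Rightarrow> nat \<Rightarrow> (int \<Rightarrow> int) \<Rightarrow> int set" where
  "Mset c1 c2 lam1 lam2 i x =
     {k. k \<noteq> 0 \<and> iota k = i \<and> sigma c1 c2 lam1 lam2 x k = sigma_max c1 c2 lam1 lam2 i x}"

text \<open>
  Crystal operators; \<^const>\<open>None\<close> plays the role of the ghost element \<open>0\<close>. The set
  \<^const>\<open>Mset\<close> may be infinite, so its maximum or minimum need not exist.
\<close>

definition e_op ::
  "int \<Rightarrow> int \<Rightarrow> int \<Rightarrow> int \<Rightarrow> nat \<Rightarrow> (int \<Rightarrow> int) \<Rightarrow> (int \<Rightarrow> int) option" where
  "e_op c1 c2 lam1 lam2 i x =
     (let M = Mset c1 c2 lam1 lam2 i x in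
      if \<exists>m\<in>M. \<forall>k\<in>M. k \<le> m
      then let m = (GREATEST k. k \<in> M) in Some (x(m := x m - 1))
      else None)"

definition f_op ::
  "int \<Rightarrow> int \<Rightarrow> int \<Rightarrow> int \<Rightarrow> nat \<Rightarrow> (int \<Rightarrow> int) \<Rightarrow> (int \<Rightarrow> int) option" where
  "f_op c1 c2 lam1 lam2 i x =
     (let M = Mset c1 c2 lam1 lam2 i x in
      if \<exists>m\<in>M. \<forall>k\<in>M. m \<le> k
      then let m = (LEAST k. k \<in> M) in Some (x(m := x m + 1))
      else None)"

definition crystal_edges ::
  "int \<Rightarrow> int \<Rightarrow> int \<Rightarrow> int \<Rightarrow> ((int \<Rightarrow> int) \<times> (int \<Rightarrow> int)) set" where
  "crystal_edges c1 c2 lam1 lam2 =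
     {(x, y). x \<in> Zinf \<and> y \<in> Zinf \<and>
        (\<exists>i\<in>index_set. f_op c1 c2 lam1 lam2 i x = Some y \<or> e_op c1 c2 lam1 lam2 i x = Some y)}"

text \<open>
  \<open>B\<^sub>0(\<lambda>)\<close>: the connected component, in the undirected crystal graph, of the zero sequence,
  which is the image of \<open>u\<^sub>\<infinity> \<otimes> t\<^sub>\<lambda> \<otimes> u\<^sub>-\<^sub>\<infinity>\<close> under the strict embedding of
  \<open>B(\<infinity>) \<otimes> T\<^sub>\<lambda> \<otimes> B(-\<infinity>)\<close>.
\<close>

definition B0 :: "int \<Rightarrow> int \<Rightarrow> int \<Rightarrow> int \<Rightarrow> (int \<Rightarrow> int) set" where
  "B0 c1 c2 lam1 lam2 =
     {x. ((\<lambda>_. 0), x) \<in> (crystal_edges c1 c2 lam1 lam2 \<union> (crystal_edges c1 c2 lam1 lam2)\<inverse>)\<^sup>*}"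

definition highest_weight_vectors ::
  "int \<Rightarrow> int \<Rightarrow> int \<Rightarrow> int \<Rightarrow> (int \<Rightarrow> int) set \<Rightarrow> (int \<Rightarrow> int) set" where
  "highest_weight_vectors c1 c2 lam1 lam2 B =
     {b \<in> B. \<forall>i\<in>index_set. e_op c1 c2 lam1 lam2 i b = None}"

definition lowest_weight_vectors ::
  "int \<Rightarrow> int \<Rightarrow> int \<Rightarrow> int \<Rightarrow> (int \<Rightarrow> int) set \<Rightarrow> (int \<Rightarrow> int) set" where
  "lowest_weight_vectors c1 c2 lam1 lam2 B =
     {b \<in> B. \<forall>i\<in>index_set. f_op c1 c2 lam1 lam2 i b = None}"

text \<open>
  The coefficients \<open>a\<^sub>0, \<dots>, a\<^sub>3\<close> for type \<open>A\<^sub>2\<close>, where \<open>a\<^sub>l = a'\<^sub>l\<close>; then \<open>h\<^sub>-\<^sub>j\<close> and \<open>l\<^sub>j\<close> for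
  \<open>j = 1, 2\<close>, and the vectors \<open>H\<^sub>-\<^sub>j\<close> and \<open>L\<^sub>j\<close>. Only \<open>j \<in> {1, 2}\<close> is meaningful.
\<close>

definition a_coeff :: "nat \<Rightarrow> int" where
  "a_coeff l = [0, 1, 1, 0] ! l"

definition h_coord :: "int \<Rightarrow> int \<Rightarrow> nat \<Rightarrow> int" where
  "h_coord lam1 lam2 j = a_coeff (j - 1) * lam1 + a_coeff j * lam2"

definition l_coord :: "int \<Rightarrow> int \<Rightarrow> nat \<Rightarrow> int" where
  "l_coord lam1 lam2 j = a_coeff j * lam1 + a_coeff (j - 1) * lam2"

definition H_vec :: "int \<Rightarrow> int \<Rightarrow> nat \<Rightarrow> int \<Rightarrow> int" where
  "H_vec lam1 lam2 j k = (if - int j \<le> k \<and> k \<le> -1 then h_coord lam1 lam2 (nat (- k)) else 0)"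

definition L_vec :: "int \<Rightarrow> int \<Rightarrow> nat \<Rightarrow> int \<Rightarrow> int" where
  "L_vec lam1 lam2 j k = (if 1 \<le> k \<and> k \<le> int j then l_coord lam1 lam2 (nat k) else 0)"

end

theory Submission
  imports Defs
begin

text \<open>
  In type \<open>A\<^sub>2\<close> the weight \<open>\<lambda>\<close> is Weyl conjugate to a dominant weight, and \<open>B\<^sub>0(\<lambda>)\<close> is the finite
  crystal of the corresponding irreducible module, with one highest and one lowest weight
  vector. In the coordinates at hand this crystal is confined to an explicit set: its sequences
  are supported on the four positions \<open>2, 1, -1, -2\<close>. Writing \<open>x\<^sub>1 = a\<close>, \<open>x\<^sub>2 = b\<close>, \<open>x\<^sub>-\<^sub>1 = -c\<close>,
  \<open>x\<^sub>-\<^sub>2 = -d\<close>, the linear inequalities of \<open>comp_coords\<close> cut out a finite set that contains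
  the zero sequence and is closed under all \<open>e\<^sub>i\<close> and \<open>f\<^sub>i\<close> (\<open>e_op_vec4\<close>, \<open>f_op_vec4\<close>).
  The operators \<open>e\<^sub>i\<close> and \<open>f\<^sub>i\<close> are mutually inverse partial maps (\<open>f_op_then_e_op\<close>,
  \<open>e_op_then_f_op\<close>), so closure under them is closure under the undirected edges, and the set
  contains \<open>B\<^sub>0(\<lambda>)\<close> (\<open>B0_in_comp_coords\<close>).

  In this set the conditions \<open>e\<^sub>1 x = e\<^sub>2 x = 0\<close> become linear inequalities with a single
  solution, and likewise for \<open>f\<^sub>1, f\<^sub>2\<close> (\<open>highest_vec4\<close>, \<open>lowest_vec4\<close>). This gives uniqueness.
  It also gives membership without exhibiting a path from the zero sequence: each \<open>e\<^sub>i\<close> lowers the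
  sum of the coordinates by one, and this sum is bounded on the set, so an element of
  \<open>B\<^sub>0(\<lambda>)\<close> of smallest coordinate sum is killed by both \<open>e\<^sub>i\<close>, hence is that unique
  solution. An element of largest coordinate sum is killed by both \<open>f\<^sub>i\<close>.

  The three cases are treated at once. The sign of \<open>\<lambda>\<^sub>1 + \<lambda>\<^sub>2\<close> decides which of \<open>b\<close>, \<open>d\<close> is forced
  to vanish, and the extremal vectors are \<open>c = -\<lambda>\<^sub>2, d = max 0 (-\<lambda>\<^sub>1 - \<lambda>\<^sub>2)\<close> and
  \<open>a = \<lambda>\<^sub>1, b = max 0 (\<lambda>\<^sub>1 + \<lambda>\<^sub>2)\<close> with the other two coordinates zero.
\<close>

section \<open>The crystal operators on sequences with finite support\<close>

text \<open>
  \<open>\<sigma>\<^sub>k(x)\<close> depends on \<open>k\<close> only through its sign, \<open>i\<^sub>k\<close>, \<open>x\<^sub>k\<close> and the part of the support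
  above \<open>k\<close>, each of which takes finitely many values. Finiteness is what makes the \<^const>\<open>Max\<close>
  in \<^const>\<open>sigma_max\<close> a true maximum.
\<close>

lemma finite_sigma_range:
  assumes "x \<in> Zinf"
  shows "finite (range (sigma c1 c2 lam1 lam2 x))"
proof -
  let ?supp = "{k. x k \<noteq> 0}"
  let ?g = "\<lambda>(neg, i, u, A). (if neg then - weight_pairing lam1 lam2 i else 0) + u
      + (\<Sum>j\<in>A. cartan c1 c2 i (iota j) * x j)"
  have fin: "finite ?supp" using assms by (simp add: Zinf_def)
  have "range x \<subseteq> insert 0 (x ` ?supp)" by auto
  then have "finite (range x)" using fin by (meson finite.insertI finite_imageI finite_subset)
  then have "finite (?g ` (UNIV \<times> {1, 2} \<times> range x \<times> Pow ?supp))"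
    using fin by (intro finite_imageI[where h = ?g]) (auto intro!: finite_cartesian_product)
  moreover have "sigma c1 c2 lam1 lam2 x k \<in> ?g ` (UNIV \<times> {1, 2} \<times> range x \<times> Pow ?supp)" for k
    by (rule image_eqI[of _ _ "(k < 0, iota k, x k, {j. j > k \<and> j \<noteq> 0 \<and> x j \<noteq> 0})"])
       (auto simp: sigma_def iota_def)
  ultimately show ?thesis by (meson finite_subset image_subsetI)
qed

text \<open>
  Replacing the support by a fixed finite set of indices allows two sequences, or one
  sequence at several \<open>k\<close>, to be compared term by term.
\<close>

lemma sigma_eq_sum:
  assumes "finite F" "{j. x j \<noteq> 0} \<subseteq> F" "0 \<notin> F"
  shows "sigma c1 c2 lam1 lam2 x k =
     (if k < 0 then - weight_pairing lam1 lam2 (iota k) else 0) + x k +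
     (\<Sum>j\<in>F. if j > k then cartan c1 c2 (iota k) (iota j) * x j else 0)"
proof -
  have "(\<Sum>j | j > k \<and> j \<noteq> 0 \<and> x j \<noteq> 0. cartan c1 c2 (iota k) (iota j) * x j)
      = (\<Sum>j | j > k \<and> j \<noteq> 0 \<and> x j \<noteq> 0. if j > k then cartan c1 c2 (iota k) (iota j) * x j else 0)"
    by (rule sum.cong) auto
  also have "\<dots> = (\<Sum>j\<in>F. if j > k then cartan c1 c2 (iota k) (iota j) * x j else 0)"
    using assms by (intro sum.mono_neutral_left) auto
  finally show ?thesis by (simp add: sigma_def)
qed

lemma sigma_upd:
  assumes "x \<in> Zinf" "m \<noteq> 0"
  shows "sigma c1 c2 lam1 lam2 (x(m := x m + t)) k = sigma c1 c2 lam1 lam2 x k +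
    (if k = m then t else if k < m then cartan c1 c2 (iota k) (iota m) * t else 0)"
proof -
  let ?F = "insert m {j. x j \<noteq> 0}"
  have F: "finite ?F" "0 \<notin> ?F" using assms by (auto simp: Zinf_def)
  have sum_upd: "(\<Sum>j\<in>?F. if j > k then cartan c1 c2 (iota k) (iota j) * (x(m := x m + t)) j else 0)
      = (\<Sum>j\<in>?F. if j > k then cartan c1 c2 (iota k) (iota j) * x j else 0)
        + (\<Sum>j\<in>?F. if j = m then (if m > k then cartan c1 c2 (iota k) (iota m) * t else 0) else 0)"
    unfolding sum.distrib[symmetric] by (rule sum.cong) (auto simp: algebra_simps)
  also have "(\<Sum>j\<in>?F. if j = m then (if m > k then cartan c1 c2 (iota k) (iota m) * t else 0) else 0)
      = (if m > k then cartan c1 c2 (iota k) (iota m) * t else 0)"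
    using F by (subst sum.delta) auto
  finally have sum_upd': "(\<Sum>j\<in>?F. if j > k then cartan c1 c2 (iota k) (iota j) * (x(m := x m + t)) j else 0)
      = (\<Sum>j\<in>?F. if j > k then cartan c1 c2 (iota k) (iota j) * x j else 0)
        + (if m > k then cartan c1 c2 (iota k) (iota m) * t else 0)" .
  have "{j. (x(m := x m + t)) j \<noteq> 0} \<subseteq> ?F" "{j. x j \<noteq> 0} \<subseteq> ?F" by auto
  note sums = this[THEN sigma_eq_sum[OF F(1) _ F(2)]]
  show ?thesis unfolding sums sum_upd' by simp
qed

text \<open>
  Left and right refer to the number line of indices, the reverse of the order in which
  sequences are written. The operator \<open>e\<^sub>i\<close> acts at the rightmost maximum of \<open>\<sigma>\<close> among the indices
  of colour \<open>i\<close> (those \<open>k\<close> with \<open>i\<^sub>k = i\<close>), and \<open>f\<^sub>i\<close> acts at the leftmost one.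
\<close>

definition rightmost_max :: "(int \<Rightarrow> int) \<Rightarrow> nat \<Rightarrow> int \<Rightarrow> bool" where
  "rightmost_max s i m \<longleftrightarrow> m \<noteq> 0 \<and> iota m = i \<and>
     (\<forall>k. k \<noteq> 0 \<and> iota k = i \<longrightarrow> s k \<le> s m \<and> (m < k \<longrightarrow> s k < s m))"

definition leftmost_max :: "(int \<Rightarrow> int) \<Rightarrow> nat \<Rightarrow> int \<Rightarrow> bool" where
  "leftmost_max s i m \<longleftrightarrow> m \<noteq> 0 \<and> iota m = i \<and>
     (\<forall>k. k \<noteq> 0 \<and> iota k = i \<longrightarrow> s k \<le> s m \<and> (k < m \<longrightarrow> s k < s m))"

lemma Mset_eq:
  assumes "x \<in> Zinf"
  shows "Mset c1 c2 lam1 lam2 i x = {m. m \<noteq> 0 \<and> iota m = i \<and>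
    (\<forall>k. k \<noteq> 0 \<and> iota k = i \<longrightarrow> sigma c1 c2 lam1 lam2 x k \<le> sigma c1 c2 lam1 lam2 x m)}"
proof -
  let ?V = "{sigma c1 c2 lam1 lam2 x k | k. k \<noteq> 0 \<and> iota k = i}"
  have fin: "finite ?V" by (rule finite_subset[OF _ finite_sigma_range[OF assms]]) auto
  have Max: "v = Max ?V \<longleftrightarrow> (\<forall>w\<in>?V. w \<le> v)" if "v \<in> ?V" for v
    using Max_ge[OF fin] Max_eqI[OF fin _ that] by blast
  have "sigma c1 c2 lam1 lam2 x m = Max ?V \<longleftrightarrow>
      (\<forall>k. k \<noteq> 0 \<and> iota k = i \<longrightarrow> sigma c1 c2 lam1 lam2 x k \<le> sigma c1 c2 lam1 lam2 x m)"
    if "m \<noteq> 0" "iota m = i" for m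
    by (subst Max) (use that in blast)+
  then show ?thesis unfolding Mset_def sigma_max_def by blast
qed

lemma e_op_eq_Some_iff:
  assumes "x \<in> Zinf"
  shows "e_op c1 c2 lam1 lam2 i x = Some y \<longleftrightarrow>
    (\<exists>m. rightmost_max (sigma c1 c2 lam1 lam2 x) i m \<and> y = x(m := x m - 1))"
proof -
  let ?M = "Mset c1 c2 lam1 lam2 i x"
  let ?s = "sigma c1 c2 lam1 lam2 x"
  have rm: "rightmost_max ?s i m \<longleftrightarrow> m \<in> ?M \<and> (\<forall>k\<in>?M. k \<le> m)" for m
  proof
    assume m: "rightmost_max ?s i m"
    then have "m \<in> ?M" by (simp add: Mset_eq[OF assms] rightmost_max_def)
    moreover have "k \<le> m" if "k \<in> ?M" for k
    proof (rule ccontr)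
      assume "\<not> k \<le> m"
      then have "?s k < ?s m" using m that unfolding Mset_eq[OF assms] rightmost_max_def by simp
      moreover have "?s m \<le> ?s k" using m that unfolding Mset_eq[OF assms] rightmost_max_def by simp
      ultimately show False by simp
    qed
    ultimately show "m \<in> ?M \<and> (\<forall>k\<in>?M. k \<le> m)" by blast
  next
    assume m: "m \<in> ?M \<and> (\<forall>k\<in>?M. k \<le> m)"
    have "?s k < ?s m" if "k \<noteq> 0" "iota k = i" "m < k" for k
    proof -
      have "k \<notin> ?M" using m that(3) by auto
      moreover have "?s k \<le> ?s m" using m that by (simp add: Mset_eq[OF assms])
      ultimately show ?thesis using m that by (simp add: Mset_def)
    qed
    then show "rightmost_max ?s i m" using m by (simp add: Mset_eq[OF assms] rightmost_max_def)
  qed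
  have G: "(GREATEST k. k \<in> ?M) = m" if "m \<in> ?M" "\<forall>k\<in>?M. k \<le> m" for m
    using that by (intro Greatest_equality) auto
  show ?thesis
  proof (cases "\<exists>m\<in>?M. \<forall>k\<in>?M. k \<le> m")
    case True
    then obtain m where m: "m \<in> ?M" "\<forall>k\<in>?M. k \<le> m" by blast
    have "e_op c1 c2 lam1 lam2 i x = Some (x(m := x m - 1))"
      unfolding e_op_def Let_def G[OF m] using True by (simp only: if_True)
    moreover have "rightmost_max ?s i m' \<longleftrightarrow> m' = m" for m'
      unfolding rm using m by (meson order_antisym)
    ultimately show ?thesis by (simp only: option.inject) blast
  next
    case False
    then have "e_op c1 c2 lam1 lam2 i x = None"
      unfolding e_op_def Let_def by (simp only: if_False)
    moreover have "\<not> rightmost_max ?s i m" for m using False unfolding rm by blast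
    ultimately show ?thesis by (simp only: option.distinct) blast
  qed
qed

lemma f_op_eq_Some_iff:
  assumes "x \<in> Zinf"
  shows "f_op c1 c2 lam1 lam2 i x = Some y \<longleftrightarrow>
    (\<exists>m. leftmost_max (sigma c1 c2 lam1 lam2 x) i m \<and> y = x(m := x m + 1))"
proof -
  let ?M = "Mset c1 c2 lam1 lam2 i x"
  let ?s = "sigma c1 c2 lam1 lam2 x"
  have lm: "leftmost_max ?s i m \<longleftrightarrow> m \<in> ?M \<and> (\<forall>k\<in>?M. m \<le> k)" for m
  proof
    assume m: "leftmost_max ?s i m"
    then have "m \<in> ?M" by (simp add: Mset_eq[OF assms] leftmost_max_def)
    moreover have "m \<le> k" if "k \<in> ?M" for k
    proof (rule ccontr)
      assume "\<not> m \<le> k"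
      then have "?s k < ?s m" using m that unfolding Mset_eq[OF assms] leftmost_max_def by simp
      moreover have "?s m \<le> ?s k" using m that unfolding Mset_eq[OF assms] leftmost_max_def by simp
      ultimately show False by simp
    qed
    ultimately show "m \<in> ?M \<and> (\<forall>k\<in>?M. m \<le> k)" by blast
  next
    assume m: "m \<in> ?M \<and> (\<forall>k\<in>?M. m \<le> k)"
    have "?s k < ?s m" if "k \<noteq> 0" "iota k = i" "k < m" for k
    proof -
      have "k \<notin> ?M" using m that(3) by auto
      moreover have "?s k \<le> ?s m" using m that by (simp add: Mset_eq[OF assms])
      ultimately show ?thesis using m that by (simp add: Mset_def)
    qed
    then show "leftmost_max ?s i m" using m by (simp add: Mset_eq[OF assms] leftmost_max_def)
  qed
  have L: "(LEAST k. k \<in> ?M) = m" if "m \<in> ?M" "\<forall>k\<in>?M. m \<le> k" for m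
    using that by (intro Least_equality) auto
  show ?thesis
  proof (cases "\<exists>m\<in>?M. \<forall>k\<in>?M. m \<le> k")
    case True
    then obtain m where m: "m \<in> ?M" "\<forall>k\<in>?M. m \<le> k" by blast
    have "f_op c1 c2 lam1 lam2 i x = Some (x(m := x m + 1))"
      unfolding f_op_def Let_def L[OF m] using True by (simp only: if_True)
    moreover have "leftmost_max ?s i m' \<longleftrightarrow> m' = m" for m'
      unfolding lm using m by (meson order_antisym)
    ultimately show ?thesis by (simp only: option.inject) blast
  next
    case False
    then have "f_op c1 c2 lam1 lam2 i x = None"
      unfolding f_op_def Let_def by (simp only: if_False)
    moreover have "\<not> leftmost_max ?s i m" for m using False unfolding lm by blast
    ultimately show ?thesis by (simp only: option.distinct) blast
  qed
qed

lemma Zinf_upd: "x \<in> Zinf \<Longrightarrow> m \<noteq> 0 \<Longrightarrow> x(m := v) \<in> Zinf"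
proof -
  assume *: "x \<in> Zinf" "m \<noteq> 0"
  have "{k. (x(m := v)) k \<noteq> 0} \<subseteq> insert m {k. x k \<noteq> 0}" by auto
  then have "finite {k. (x(m := v)) k \<noteq> 0}"
    using * by (rule_tac finite_subset) (auto simp: Zinf_def)
  with * show ?thesis by (simp add: Zinf_def)
qed

text \<open>
  Raising \<open>x\<^sub>m\<close> by one adds \<open>1\<close> to \<open>\<sigma>\<^sub>m\<close>, adds \<open>2\<close> to \<open>\<sigma>\<^sub>k\<close> for \<open>k < m\<close> with \<open>i\<^sub>k = i\<^sub>m\<close>, and changes
  no \<open>\<sigma>\<^sub>k\<close> with \<open>k > m\<close>. If \<open>m\<close> was the smallest maximal index of its colour, then
  \<open>\<sigma>\<^sub>k \<le> \<sigma>\<^sub>m - 1\<close> held for \<open>k < m\<close>, so these at most catch up with the new \<open>\<sigma>\<^sub>m\<close>, while the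
  \<open>\<sigma>\<^sub>k\<close> with \<open>k > m\<close> fall behind it. Hence \<open>m\<close> becomes the largest maximal index.
\<close>

lemma f_op_then_e_op:
  assumes x: "x \<in> Zinf" and f: "f_op c1 c2 lam1 lam2 i x = Some y"
  shows "e_op c1 c2 lam1 lam2 i y = Some x"
proof -
  from f obtain m where m: "leftmost_max (sigma c1 c2 lam1 lam2 x) i m" and y: "y = x(m := x m + 1)"
    unfolding f_op_eq_Some_iff[OF x] by blast
  have m0: "m \<noteq> 0" using m by (simp add: leftmost_max_def)
  have s: "sigma c1 c2 lam1 lam2 y k = sigma c1 c2 lam1 lam2 x k + (if k = m then 1 else if k < m then 2 else 0)"
    if "iota k = i" for k
    unfolding y sigma_upd[OF x m0] using m that by (simp add: cartan_def leftmost_max_def)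
  have "rightmost_max (sigma c1 c2 lam1 lam2 y) i m"
    unfolding rightmost_max_def
  proof (intro conjI allI impI)
    show "m \<noteq> 0" "iota m = i" using m by (simp_all add: leftmost_max_def)
    fix k assume k: "k \<noteq> 0 \<and> iota k = i"
    then have *: "sigma c1 c2 lam1 lam2 x k \<le> sigma c1 c2 lam1 lam2 x m"
      "k < m \<Longrightarrow> sigma c1 c2 lam1 lam2 x k < sigma c1 c2 lam1 lam2 x m"
      using m by (simp_all add: leftmost_max_def)
    show "sigma c1 c2 lam1 lam2 y k \<le> sigma c1 c2 lam1 lam2 y m"
      using * s[of k] s[of m] k \<open>iota m = i\<close> by (auto split: if_splits)
    show "sigma c1 c2 lam1 lam2 y k < sigma c1 c2 lam1 lam2 y m" if "m < k"
      using * s[of k] s[of m] k \<open>iota m = i\<close> that by (auto split: if_splits)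
  qed
  moreover have "x = y(m := y m - 1)" by (simp add: y)
  moreover have y_Zinf: "y \<in> Zinf" unfolding y using x m0 by (rule Zinf_upd)
  ultimately show ?thesis unfolding e_op_eq_Some_iff[OF y_Zinf] by blast
qed

lemma e_op_then_f_op:
  assumes x: "x \<in> Zinf" and e: "e_op c1 c2 lam1 lam2 i x = Some y"
  shows "f_op c1 c2 lam1 lam2 i y = Some x"
proof -
  from e obtain m where m: "rightmost_max (sigma c1 c2 lam1 lam2 x) i m" and y: "y = x(m := x m + - 1)"
    unfolding e_op_eq_Some_iff[OF x] by auto
  have m0: "m \<noteq> 0" using m by (simp add: rightmost_max_def)
  have s: "sigma c1 c2 lam1 lam2 y k = sigma c1 c2 lam1 lam2 x k + (if k = m then - 1 else if k < m then - 2 else 0)"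
    if "iota k = i" for k
    unfolding y sigma_upd[OF x m0] using m that by (simp add: cartan_def rightmost_max_def)
  have "leftmost_max (sigma c1 c2 lam1 lam2 y) i m"
    unfolding leftmost_max_def
  proof (intro conjI allI impI)
    show "m \<noteq> 0" "iota m = i" using m by (simp_all add: rightmost_max_def)
    fix k assume k: "k \<noteq> 0 \<and> iota k = i"
    then have *: "sigma c1 c2 lam1 lam2 x k \<le> sigma c1 c2 lam1 lam2 x m"
      "m < k \<Longrightarrow> sigma c1 c2 lam1 lam2 x k < sigma c1 c2 lam1 lam2 x m"
      using m by (simp_all add: rightmost_max_def)
    show "sigma c1 c2 lam1 lam2 y k \<le> sigma c1 c2 lam1 lam2 y m"
      using * s[of k] s[of m] k \<open>iota m = i\<close> by (auto split: if_splits)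
    show "sigma c1 c2 lam1 lam2 y k < sigma c1 c2 lam1 lam2 y m" if "k < m"
      using * s[of k] s[of m] k \<open>iota m = i\<close> that by (auto split: if_splits)
  qed
  moreover have "x = y(m := y m + 1)" by (simp add: y)
  moreover have y_Zinf: "y \<in> Zinf" unfolding y using x m0 by (rule Zinf_upd)
  ultimately show ?thesis unfolding f_op_eq_Some_iff[OF y_Zinf] by blast
qed

text \<open>
  Traversing an edge backwards is applying the inverse operator, so a set closed under the
  operators absorbs the whole undirected component.
\<close>

lemma B0_subset:
  assumes "(\<lambda>_. 0) \<in> S" and "S \<subseteq> Zinf"
    and e: "\<And>i x y. i \<in> index_set \<Longrightarrow> x \<in> S \<Longrightarrow> e_op c1 c2 lam1 lam2 i x = Some y \<Longrightarrow> y \<in> S"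
    and f: "\<And>i x y. i \<in> index_set \<Longrightarrow> x \<in> S \<Longrightarrow> f_op c1 c2 lam1 lam2 i x = Some y \<Longrightarrow> y \<in> S"
  shows "B0 c1 c2 lam1 lam2 \<subseteq> S"
proof
  fix x assume "x \<in> B0 c1 c2 lam1 lam2"
  then have "((\<lambda>_. 0), x) \<in> (crystal_edges c1 c2 lam1 lam2 \<union> (crystal_edges c1 c2 lam1 lam2)\<inverse>)\<^sup>*"
    unfolding B0_def by (rule CollectD)
  then show "x \<in> S"
  proof (induction rule: rtrancl_induct)
    case (step y z)
    let ?edge = "\<lambda>u v. u \<in> Zinf \<and> (\<exists>i\<in>index_set.
      f_op c1 c2 lam1 lam2 i u = Some v \<or> e_op c1 c2 lam1 lam2 i u = Some v)"
    from step.hyps(2) have "?edge y z \<or> ?edge z y" unfolding crystal_edges_def by blast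
    then obtain i where "i \<in> index_set" and
      "f_op c1 c2 lam1 lam2 i y = Some z \<or> e_op c1 c2 lam1 lam2 i y = Some z"
      using f_op_then_e_op e_op_then_f_op by blast
    then show ?case using e f step.IH by blast
  qed (rule assms(1))
qed

lemma B0_step:
  assumes "x \<in> B0 c1 c2 lam1 lam2" "x \<in> Zinf" "y \<in> Zinf" "i \<in> index_set"
    and "e_op c1 c2 lam1 lam2 i x = Some y \<or> f_op c1 c2 lam1 lam2 i x = Some y"
  shows "y \<in> B0 c1 c2 lam1 lam2"
proof -
  have "(x, y) \<in> crystal_edges c1 c2 lam1 lam2"
    using assms(2-5) unfolding crystal_edges_def by blast
  then show ?thesis
    using assms(1) unfolding B0_def by (blast intro: rtrancl_into_rtrancl)
qed

section \<open>An explicit set containing the component\<close>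

definition vec4 :: "int \<Rightarrow> int \<Rightarrow> int \<Rightarrow> int \<Rightarrow> int \<Rightarrow> int" where
  "vec4 a b c d = (\<lambda>_. 0)(1 := a, 2 := b, -1 := - c, -2 := - d)"

text \<open>
  If \<open>\<lambda>\<^sub>1 + \<lambda>\<^sub>2 \<ge> 0\<close> the inequalities reduce to \<open>d = 0\<close>, \<open>0 \<le> b \<le> min a (\<lambda>\<^sub>1 + \<lambda>\<^sub>2)\<close>,
  \<open>0 \<le> c \<le> -\<lambda>\<^sub>2\<close> and \<open>a + c \<le> \<lambda>\<^sub>1\<close>. The other sign is the mirror image under \<open>a \<leftrightarrow> c\<close>, \<open>b \<leftrightarrow> d\<close>,
  \<open>\<lambda>\<^sub>1 \<leftrightarrow> -\<lambda>\<^sub>2\<close>, which is the duality \<open>x\<^sub>k \<mapsto> -x\<^sub>-\<^sub>k\<close> exchanging the \<open>e\<^sub>i\<close> with the \<open>f\<^sub>i\<close>. The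
  minus signs in \<^const>\<open>vec4\<close> make all four coordinates nonnegative.
\<close>

definition comp_coords :: "int \<Rightarrow> int \<Rightarrow> (int \<times> int \<times> int \<times> int) set" where
  "comp_coords lam1 lam2 = {(a, b, c, d).
     0 \<le> b \<and> b \<le> a \<and> b \<le> max 0 (lam1 + lam2) \<and> a \<le> lam1 \<and>
     0 \<le> d \<and> d \<le> c \<and> d \<le> max 0 (- lam1 - lam2) \<and> c \<le> - lam2 \<and>
     a + c \<le> max lam1 (- lam2)}"

lemma vec4_upd:
  "(vec4 a b c d)(1 := a') = vec4 a' b c d" "(vec4 a b c d)(2 := b') = vec4 a b' c d"
  "(vec4 a b c d)(-1 := - c') = vec4 a b c' d" "(vec4 a b c d)(-2 := - d') = vec4 a b c d'"
  by (auto simp: vec4_def fun_eq_iff)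

lemma vec4_apply:
  "vec4 a b c d 1 = a" "vec4 a b c d 2 = b" "vec4 a b c d (-1) = - c" "vec4 a b c d (-2) = - d"
  by (auto simp: vec4_def)

lemma vec4_inject: "vec4 a b c d = vec4 a' b' c' d' \<longleftrightarrow> a = a' \<and> b = b' \<and> c = c' \<and> d = d'"
  by (metis vec4_apply neg_equal_iff_equal)

lemma vec4_Zinf: "vec4 a b c d \<in> Zinf"
proof -
  have "{k. vec4 a b c d k \<noteq> 0} \<subseteq> {-2, -1, 1, 2}" by (auto simp: vec4_def)
  then have "finite {k. vec4 a b c d k \<noteq> 0}" by (rule finite_subset) simp
  moreover have "vec4 a b c d 0 = 0" by (simp add: vec4_def)
  ultimately show ?thesis by (simp add: Zinf_def)
qed

lemma sigma_vec4:
  "sigma 1 1 lam1 lam2 (vec4 a b c d) k =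
     (if k < 0 then - weight_pairing lam1 lam2 (iota k) else 0) + vec4 a b c d k
      + (if k < -2 then - cartan 1 1 (iota k) 1 * d else 0)
      + (if k < -1 then - cartan 1 1 (iota k) 2 * c else 0)
      + (if k < 1 then cartan 1 1 (iota k) 1 * a else 0)
      + (if k < 2 then cartan 1 1 (iota k) 2 * b else 0)"
proof -
  have "{j. vec4 a b c d j \<noteq> 0} \<subseteq> {-2, -1, 1, 2}" by (auto simp: vec4_def)
  from sigma_eq_sum[OF _ this] show ?thesis by (simp add: vec4_apply iota_def)
qed

text \<open>
  On either side of the support \<open>\<sigma>\<^sub>k\<close> is constant along the indices of one colour, so for each
  colour only four values matter. They correspond to the four cases below.
\<close>

lemma iota_1_cases:
  assumes "k \<noteq> 0" "iota k = 1"
  obtains "k \<ge> 3" | "k = 1" | "k = -2" | "k \<le> -4"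
proof -
  have "k \<noteq> 2" "k \<noteq> -1" "k \<noteq> -3" using assms(2) by (auto simp: iota_def)
  with assms(1) that show ?thesis by linarith
qed

lemma iota_2_cases:
  assumes "k \<noteq> 0" "iota k = 2"
  obtains "k \<ge> 4" | "k = 2" | "k = -1" | "k \<le> -3"
proof -
  have "k \<noteq> 1" "k \<noteq> 3" "k \<noteq> -2" using assms(2) by (auto simp: iota_def)
  with assms(1) that show ?thesis by linarith
qed

lemma sigma_vec4_1:
  assumes "k \<noteq> 0" "iota k = 1"
  shows "sigma 1 1 lam1 lam2 (vec4 a b c d) k =
    (if k \<ge> 3 then 0 else if k = 1 then a - b
     else if k = -2 then - lam1 + 2 * a - b + c - d else - lam1 + 2 * a - b + c - 2 * d)"
  unfolding sigma_vec4 assms(2)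
  using assms by (cases rule: iota_1_cases) (simp_all add: cartan_def weight_pairing_def vec4_def)

lemma sigma_vec4_2:
  assumes "k \<noteq> 0" "iota k = 2"
  shows "sigma 1 1 lam1 lam2 (vec4 a b c d) k =
    (if k \<ge> 4 then 0 else if k = 2 then b
     else if k = -1 then - lam2 - c + 2 * b - a else - lam2 - 2 * c + d + 2 * b - a)"
  unfolding sigma_vec4 assms(2)
  using assms by (cases rule: iota_2_cases) (simp_all add: cartan_def weight_pairing_def vec4_def)

section \<open>Positions at which the operators act\<close>

text \<open>
  A maximum attained outside the positions \<open>-2, \<dots>, 2\<close> never supplies an index for \<open>e\<^sub>i\<close>. To the left
  of the support the value is infinitely repeated, and it is at most the value at
  the negative position \<open>-2\<close> or \<open>-1\<close> of that colour, from which it differs by \<open>d\<close> or by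
  \<open>c - d\<close>. To the right of the support the value is \<open>0\<close>, repeated at arbitrarily large
  indices, so only a strictly positive maximum counts. For \<open>f\<^sub>i\<close> the roles are exchanged: the value at the negative position
  must strictly exceed the constant value on its left, that is \<open>d > 0\<close> or \<open>c > d\<close>, and the
  value \<open>0\<close> on the right is no obstruction because it is at most \<open>a - b\<close> or \<open>b\<close>.
\<close>

lemma rightmost_max_vec4_1:
  assumes "0 \<le> d"
  shows "rightmost_max (sigma 1 1 lam1 lam2 (vec4 a b c d)) 1 m \<longleftrightarrow>
     m = 1 \<and> - lam1 + 2 * a - b + c - d \<le> a - b \<and> 0 < a - b \<or>
     m = -2 \<and> a - b < - lam1 + 2 * a - b + c - d \<and> 0 < - lam1 + 2 * a - b + c - d"
    (is "rightmost_max ?s 1 m \<longleftrightarrow> ?R")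
proof
  assume m: "rightmost_max ?s 1 m"
  then have m': "m \<noteq> 0" "iota m = 1" by (simp_all add: rightmost_max_def)
  have le: "?s k \<le> ?s m" "m < k \<Longrightarrow> ?s k < ?s m" if "k \<noteq> 0" "iota k = 1" for k
    using m that by (simp_all add: rightmost_max_def)
  have iota: "iota 1 = 1" "iota (-2) = 1" "iota 3 = 1" "iota (-4) = 1"
    by (simp_all add: iota_def)
  from m' show ?R
  proof (cases rule: iota_1_cases)
    case 1
    \<comment> \<open>\<open>m + 2\<close> is the next index of the same colour and carries the same value \<open>0\<close>\<close>
    have "iota (m + 2) = 1" using m' 1 by (auto simp: iota_def split: if_splits)
    then show ?thesis
      using 1 m' iota assms le[of "m + 2"] le[of 1] by (simp add: sigma_vec4_1)
  next
    case 2
    then show ?thesis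
      using m' iota assms le[of 3] le[of "-2"] by (simp add: sigma_vec4_1)
  next
    case 3
    then show ?thesis
      using m' iota assms le[of 3] le[of 1] le[of "-4"] by (simp add: sigma_vec4_1)
  next
    case 4
    have "iota (m - 2) = 1" using m' 4 by (auto simp: iota_def split: if_splits)
    then show ?thesis
      using 4 m' iota assms le[of "m - 2"] le[of "-2"] by (simp add: sigma_vec4_1)
  qed
next
  assume R: ?R
  then have m: "m \<noteq> 0" "iota m = 1" by (auto simp: iota_def)
  have "?s k \<le> ?s m \<and> (m < k \<longrightarrow> ?s k < ?s m)" if "k \<noteq> 0" "iota k = 1" for k
    using that
    by (cases rule: iota_1_cases) (use R assms that m in \<open>auto simp: sigma_vec4_1\<close>)
  then show "rightmost_max ?s 1 m" using m by (simp add: rightmost_max_def)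
qed

lemma rightmost_max_vec4_2:
  assumes "d \<le> c"
  shows "rightmost_max (sigma 1 1 lam1 lam2 (vec4 a b c d)) 2 m \<longleftrightarrow>
     m = 2 \<and> - lam2 - c + 2 * b - a \<le> b \<and> 0 < b \<or>
     m = -1 \<and> b < - lam2 - c + 2 * b - a \<and> 0 < - lam2 - c + 2 * b - a"
    (is "rightmost_max ?s 2 m \<longleftrightarrow> ?R")
proof
  assume m: "rightmost_max ?s 2 m"
  then have m': "m \<noteq> 0" "iota m = 2" by (simp_all add: rightmost_max_def)
  have le: "?s k \<le> ?s m" "m < k \<Longrightarrow> ?s k < ?s m" if "k \<noteq> 0" "iota k = 2" for k
    using m that by (simp_all add: rightmost_max_def)
  have iota: "iota 2 = 2" "iota (-1) = 2" "iota 4 = 2" "iota (-3) = 2"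
    by (simp_all add: iota_def)
  from m' show ?R
  proof (cases rule: iota_2_cases)
    case 1
    have "iota (m + 2) = 2" using m' 1 by (auto simp: iota_def split: if_splits)
    then show ?thesis
      using 1 m' iota assms le[of "m + 2"] le[of 2] by (simp add: sigma_vec4_2)
  next
    case 2
    then show ?thesis
      using m' iota assms le[of 4] le[of "-1"] by (simp add: sigma_vec4_2)
  next
    case 3
    then show ?thesis
      using m' iota assms le[of 4] le[of 2] le[of "-3"] by (simp add: sigma_vec4_2)
  next
    case 4
    have "iota (m - 2) = 2" using m' 4 by (auto simp: iota_def split: if_splits)
    then show ?thesis
      using 4 m' iota assms le[of "m - 2"] le[of "-1"] by (simp add: sigma_vec4_2)
  qed
next
  assume R: ?R
  then have m: "m \<noteq> 0" "iota m = 2" by (auto simp: iota_def)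
  have "?s k \<le> ?s m \<and> (m < k \<longrightarrow> ?s k < ?s m)" if "k \<noteq> 0" "iota k = 2" for k
    using that
    by (cases rule: iota_2_cases) (use R assms that m in \<open>auto simp: sigma_vec4_2\<close>)
  then show "rightmost_max ?s 2 m" using m by (simp add: rightmost_max_def)
qed

lemma leftmost_max_vec4_1:
  assumes "b \<le> a" "0 \<le> d"
  shows "leftmost_max (sigma 1 1 lam1 lam2 (vec4 a b c d)) 1 m \<longleftrightarrow>
     m = 1 \<and> - lam1 + 2 * a - b + c - d < a - b \<or>
     m = -2 \<and> a - b \<le> - lam1 + 2 * a - b + c - d \<and> 0 < d"
    (is "leftmost_max ?s 1 m \<longleftrightarrow> ?R")
proof
  assume m: "leftmost_max ?s 1 m"
  then have m': "m \<noteq> 0" "iota m = 1" by (simp_all add: leftmost_max_def)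
  have le: "?s k \<le> ?s m" "k < m \<Longrightarrow> ?s k < ?s m" if "k \<noteq> 0" "iota k = 1" for k
    using m that by (simp_all add: leftmost_max_def)
  have iota: "iota 1 = 1" "iota (-2) = 1" "iota 3 = 1" "iota (-4) = 1"
    by (simp_all add: iota_def)
  from m' show ?R
  proof (cases rule: iota_1_cases)
    case 1
    have "iota (m + 2) = 1" using m' 1 by (auto simp: iota_def split: if_splits)
    then show ?thesis
      using 1 m' iota assms le[of "m + 2"] le[of 1] by (simp add: sigma_vec4_1)
  next
    case 2
    then show ?thesis
      using m' iota assms le[of 3] le[of "-2"] by (simp add: sigma_vec4_1)
  next
    case 3
    then show ?thesis
      using m' iota assms le[of 3] le[of 1] le[of "-4"] by (simp add: sigma_vec4_1)
  next
    case 4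
    have "iota (m - 2) = 1" using m' 4 by (auto simp: iota_def split: if_splits)
    then show ?thesis
      using 4 m' iota assms le[of "m - 2"] le[of "-2"] by (simp add: sigma_vec4_1)
  qed
next
  assume R: ?R
  then have m: "m \<noteq> 0" "iota m = 1" by (auto simp: iota_def)
  have "?s k \<le> ?s m \<and> (k < m \<longrightarrow> ?s k < ?s m)" if "k \<noteq> 0" "iota k = 1" for k
    using that
    by (cases rule: iota_1_cases) (use R assms that m in \<open>auto simp: sigma_vec4_1\<close>)
  then show "leftmost_max ?s 1 m" using m by (simp add: leftmost_max_def)
qed

lemma leftmost_max_vec4_2:
  assumes "0 \<le> b" "d \<le> c"
  shows "leftmost_max (sigma 1 1 lam1 lam2 (vec4 a b c d)) 2 m \<longleftrightarrow>
     m = 2 \<and> - lam2 - c + 2 * b - a < b \<or>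
     m = -1 \<and> b \<le> - lam2 - c + 2 * b - a \<and> d < c"
    (is "leftmost_max ?s 2 m \<longleftrightarrow> ?R")
proof
  assume m: "leftmost_max ?s 2 m"
  then have m': "m \<noteq> 0" "iota m = 2" by (simp_all add: leftmost_max_def)
  have le: "?s k \<le> ?s m" "k < m \<Longrightarrow> ?s k < ?s m" if "k \<noteq> 0" "iota k = 2" for k
    using m that by (simp_all add: leftmost_max_def)
  have iota: "iota 2 = 2" "iota (-1) = 2" "iota 4 = 2" "iota (-3) = 2"
    by (simp_all add: iota_def)
  from m' show ?R
  proof (cases rule: iota_2_cases)
    case 1
    have "iota (m + 2) = 2" using m' 1 by (auto simp: iota_def split: if_splits)
    then show ?thesis
      using 1 m' iota assms le[of "m + 2"] le[of 2] by (simp add: sigma_vec4_2)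
  next
    case 2
    then show ?thesis
      using m' iota assms le[of 4] le[of "-1"] by (simp add: sigma_vec4_2)
  next
    case 3
    then show ?thesis
      using m' iota assms le[of 4] le[of 2] le[of "-3"] by (simp add: sigma_vec4_2)
  next
    case 4
    have "iota (m - 2) = 2" using m' 4 by (auto simp: iota_def split: if_splits)
    then show ?thesis
      using 4 m' iota assms le[of "m - 2"] le[of "-1"] by (simp add: sigma_vec4_2)
  qed
next
  assume R: ?R
  then have m: "m \<noteq> 0" "iota m = 2" by (auto simp: iota_def)
  have "?s k \<le> ?s m \<and> (k < m \<longrightarrow> ?s k < ?s m)" if "k \<noteq> 0" "iota k = 2" for k
    using that
    by (cases rule: iota_2_cases) (use R assms that m in \<open>auto simp: sigma_vec4_2\<close>)
  then show "leftmost_max ?s 2 m" using m by (simp add: leftmost_max_def)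
qed

section \<open>Closure of the coordinate set and its extremal vectors\<close>

text \<open>
  In each case the inequality that selects the position is exactly what keeps the new
  coordinates admissible. For instance, \<open>e\<^sub>1\<close> acts at \<open>-2\<close> only if \<open>d < a + c - \<lambda>\<^sub>1\<close>, whence
  \<open>d < c\<close> because \<open>a \<le> \<lambda>\<^sub>1\<close>, and \<open>d < max 0 (-\<lambda>\<^sub>1 - \<lambda>\<^sub>2)\<close> because \<open>a + c \<le> max \<lambda>\<^sub>1 (-\<lambda>\<^sub>2)\<close>. The third
  conclusion records the change of the coordinate sum for the extremality argument.
\<close>

lemma e_op_vec4:
  assumes "(a, b, c, d) \<in> comp_coords lam1 lam2" "i \<in> index_set"
    and "e_op 1 1 lam1 lam2 i (vec4 a b c d) = Some y"
  obtains a' b' c' d' where "y = vec4 a' b' c' d'" "(a', b', c', d') \<in> comp_coords lam1 lam2"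
    "a' + b' - c' - d' = a + b - c - d - 1"
proof -
  have rng: "d \<le> c" "0 \<le> d" using assms(1) by (simp_all add: comp_coords_def)
  obtain m where m: "rightmost_max (sigma 1 1 lam1 lam2 (vec4 a b c d)) i m"
    and y: "y = (vec4 a b c d)(m := vec4 a b c d m - 1)"
    using assms(3) unfolding e_op_eq_Some_iff[OF vec4_Zinf] by blast
  have "i = 1 \<or> i = 2" using assms(2) by (simp add: index_set_def)
  then consider
      "m = 1" "- lam1 + 2 * a - b + c - d \<le> a - b" "0 < a - b"
    | "m = -2" "a - b < - lam1 + 2 * a - b + c - d"
    | "m = 2" "0 < b"
    | "m = -1" "b < - lam2 - c + 2 * b - a"
  proof (elim disjE)
    assume "i = 1"
    then show ?thesis using m that(1,2) by (simp only: rightmost_max_vec4_1[OF rng(2)]) blast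
  next
    assume "i = 2"
    then show ?thesis using m that(3,4) by (simp only: rightmost_max_vec4_2[OF rng(1)]) blast
  qed
  then show ?thesis
  proof cases
    case 1
    then have "y = vec4 (a - 1) b c d" by (simp add: y vec4_apply vec4_upd)
    moreover have "(a - 1, b, c, d) \<in> comp_coords lam1 lam2"
      using assms(1) 1 by (auto simp: comp_coords_def)
    ultimately show ?thesis using that by simp
  next
    case 2
    then have "y = (vec4 a b c d)(-2 := - (d + 1))" by (simp add: y vec4_apply)
    then have "y = vec4 a b c (d + 1)" by (simp only: vec4_upd)
    moreover have "(a, b, c, d + 1) \<in> comp_coords lam1 lam2"
      using assms(1) 2 by (auto simp: comp_coords_def)
    ultimately show ?thesis using that by simp
  next
    case 3
    then have "y = vec4 a (b - 1) c d" by (simp add: y vec4_apply vec4_upd)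
    moreover have "(a, b - 1, c, d) \<in> comp_coords lam1 lam2"
      using assms(1) 3 by (auto simp: comp_coords_def)
    ultimately show ?thesis using that by simp
  next
    case 4
    then have "y = (vec4 a b c d)(-1 := - (c + 1))" by (simp add: y vec4_apply)
    then have "y = vec4 a b (c + 1) d" by (simp only: vec4_upd)
    moreover have "(a, b, c + 1, d) \<in> comp_coords lam1 lam2"
      using assms(1) 4 by (auto simp: comp_coords_def)
    ultimately show ?thesis using that by simp
  qed
qed

lemma f_op_vec4:
  assumes "(a, b, c, d) \<in> comp_coords lam1 lam2" "i \<in> index_set"
    and "f_op 1 1 lam1 lam2 i (vec4 a b c d) = Some y"
  obtains a' b' c' d' where "y = vec4 a' b' c' d'" "(a', b', c', d') \<in> comp_coords lam1 lam2"
    "a' + b' - c' - d' = a + b - c - d + 1"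
proof -
  have rng: "b \<le> a" "0 \<le> d" "0 \<le> b" "d \<le> c" using assms(1) by (simp_all add: comp_coords_def)
  obtain m where m: "leftmost_max (sigma 1 1 lam1 lam2 (vec4 a b c d)) i m"
    and y: "y = (vec4 a b c d)(m := vec4 a b c d m + 1)"
    using assms(3) unfolding f_op_eq_Some_iff[OF vec4_Zinf] by blast
  have "i = 1 \<or> i = 2" using assms(2) by (simp add: index_set_def)
  then consider
      "m = 1" "- lam1 + 2 * a - b + c - d < a - b"
    | "m = -2" "0 < d"
    | "m = 2" "- lam2 - c + 2 * b - a < b"
    | "m = -1" "b \<le> - lam2 - c + 2 * b - a" "d < c"
  proof (elim disjE)
    assume "i = 1"
    then show ?thesis using m that(1,2) by (simp only: leftmost_max_vec4_1[OF rng(1,2)]) blast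
  next
    assume "i = 2"
    then show ?thesis using m that(3,4) by (simp only: leftmost_max_vec4_2[OF rng(3,4)]) blast
  qed
  then show ?thesis
  proof cases
    case 1
    then have "y = vec4 (a + 1) b c d" by (simp add: y vec4_apply vec4_upd)
    moreover have "(a + 1, b, c, d) \<in> comp_coords lam1 lam2"
      using assms(1) 1 by (auto simp: comp_coords_def)
    ultimately show ?thesis using that by simp
  next
    case 2
    then have "y = (vec4 a b c d)(-2 := - (d - 1))" by (simp add: y vec4_apply)
    then have "y = vec4 a b c (d - 1)" by (simp only: vec4_upd)
    moreover have "(a, b, c, d - 1) \<in> comp_coords lam1 lam2"
      using assms(1) 2 by (auto simp: comp_coords_def)
    ultimately show ?thesis using that by simp
  next
    case 3
    then have "y = vec4 a (b + 1) c d" by (simp add: y vec4_apply vec4_upd)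
    moreover have "(a, b + 1, c, d) \<in> comp_coords lam1 lam2"
      using assms(1) 3 by (auto simp: comp_coords_def)
    ultimately show ?thesis using that by simp
  next
    case 4
    then have "y = (vec4 a b c d)(-1 := - (c - 1))" by (simp add: y vec4_apply)
    then have "y = vec4 a b (c - 1) d" by (simp only: vec4_upd)
    moreover have "(a, b, c - 1, d) \<in> comp_coords lam1 lam2"
      using assms(1) 4 by (auto simp: comp_coords_def)
    ultimately show ?thesis using that by simp
  qed
qed

text \<open>
  If no \<open>e\<^sub>i\<close> acts, the values at \<open>1, 2, -1, -2\<close> are all nonpositive, so \<open>a = b = 0\<close> at positions
  \<open>1, 2\<close>. Position \<open>-1\<close> then gives \<open>c \<ge> -\<lambda>\<^sub>2\<close> and position \<open>-2\<close> gives
  \<open>d \<ge> -\<lambda>\<^sub>1 - \<lambda>\<^sub>2\<close>, and the upper bounds of \<^const>\<open>comp_coords\<close> turn both into equalities.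
\<close>

lemma highest_vec4:
  assumes "(a, b, c, d) \<in> comp_coords lam1 lam2"
    and "\<forall>i\<in>index_set. e_op 1 1 lam1 lam2 i (vec4 a b c d) = None"
  shows "a = 0 \<and> b = 0 \<and> c = - lam2 \<and> d = max 0 (- lam1 - lam2)"
proof -
  have rng: "0 \<le> d" "d \<le> c" using assms(1) by (simp_all add: comp_coords_def)
  have none: "\<not> rightmost_max (sigma 1 1 lam1 lam2 (vec4 a b c d)) i m" if "i \<in> index_set" for i m
  proof
    assume "rightmost_max (sigma 1 1 lam1 lam2 (vec4 a b c d)) i m"
    then have "\<exists>y. e_op 1 1 lam1 lam2 i (vec4 a b c d) = Some y"
      unfolding e_op_eq_Some_iff[OF vec4_Zinf] by blast
    then show False using assms(2) that by simp
  qed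
  have "\<not> (- lam1 + 2 * a - b + c - d \<le> a - b \<and> 0 < a - b)"
       "\<not> (a - b < - lam1 + 2 * a - b + c - d \<and> 0 < - lam1 + 2 * a - b + c - d)"
    using none[of 1, unfolded rightmost_max_vec4_1[OF rng(1)]]
    by (simp_all add: index_set_def)
  moreover have "\<not> (- lam2 - c + 2 * b - a \<le> b \<and> 0 < b)"
       "\<not> (b < - lam2 - c + 2 * b - a \<and> 0 < - lam2 - c + 2 * b - a)"
    using none[of 2, unfolded rightmost_max_vec4_2[OF rng(2)]]
    by (simp_all add: index_set_def)
  ultimately show ?thesis using assms(1) unfolding comp_coords_def by auto
qed

text \<open>
  If no \<open>f\<^sub>i\<close> acts, then the value at the negative position of each colour is at least the one at
  the positive position, so \<open>d = 0\<close> and then \<open>c = d = 0\<close>. What remains is \<open>a \<ge> \<lambda>\<^sub>1\<close> and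
  \<open>b \<ge> a + \<lambda>\<^sub>2\<close>, which together with the upper bounds determine \<open>a\<close> and \<open>b\<close>.
\<close>

lemma lowest_vec4:
  assumes "(a, b, c, d) \<in> comp_coords lam1 lam2"
    and "\<forall>i\<in>index_set. f_op 1 1 lam1 lam2 i (vec4 a b c d) = None"
  shows "a = lam1 \<and> b = max 0 (lam1 + lam2) \<and> c = 0 \<and> d = 0"
proof -
  have rng: "b \<le> a" "0 \<le> d" "0 \<le> b" "d \<le> c" using assms(1) by (simp_all add: comp_coords_def)
  have none: "\<not> leftmost_max (sigma 1 1 lam1 lam2 (vec4 a b c d)) i m" if "i \<in> index_set" for i m
  proof
    assume "leftmost_max (sigma 1 1 lam1 lam2 (vec4 a b c d)) i m"
    then have "\<exists>y. f_op 1 1 lam1 lam2 i (vec4 a b c d) = Some y"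
      unfolding f_op_eq_Some_iff[OF vec4_Zinf] by blast
    then show False using assms(2) that by simp
  qed
  have "\<not> (- lam1 + 2 * a - b + c - d < a - b)"
       "\<not> (a - b \<le> - lam1 + 2 * a - b + c - d \<and> 0 < d)"
    using none[of 1, unfolded leftmost_max_vec4_1[OF rng(1,2)]]
    by (simp_all add: index_set_def)
  moreover have "\<not> (- lam2 - c + 2 * b - a < b)"
       "\<not> (b \<le> - lam2 - c + 2 * b - a \<and> d < c)"
    using none[of 2, unfolded leftmost_max_vec4_2[OF rng(3,4)]]
    by (simp_all add: index_set_def)
  ultimately show ?thesis using assms(1) unfolding comp_coords_def by auto
qed

lemma B0_in_comp_coords:
  assumes "lam1 > 0" "lam2 < 0" "x \<in> B0 1 1 lam1 lam2"
  obtains a b c d where "x = vec4 a b c d" "(a, b, c, d) \<in> comp_coords lam1 lam2"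
proof -
  let ?S = "{vec4 a b c d | a b c d. (a, b, c, d) \<in> comp_coords lam1 lam2}"
  have "(\<lambda>_. 0) = vec4 0 0 0 0" by (auto simp: vec4_def)
  moreover have "(0, 0, 0, 0) \<in> comp_coords lam1 lam2" using assms(1,2) by (simp add: comp_coords_def)
  ultimately have "(\<lambda>_. 0) \<in> ?S" by blast
  moreover have "?S \<subseteq> Zinf" using vec4_Zinf by blast
  ultimately have "B0 1 1 lam1 lam2 \<subseteq> ?S"
  proof (rule B0_subset)
    show "y \<in> ?S" if "i \<in> index_set" "x \<in> ?S" "e_op 1 1 lam1 lam2 i x = Some y" for i x y
    proof -
      obtain a b c d where "x = vec4 a b c d" "(a, b, c, d) \<in> comp_coords lam1 lam2"
        using \<open>x \<in> ?S\<close> by blast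
      with that show ?thesis by (blast elim: e_op_vec4)
    qed
    show "y \<in> ?S" if "i \<in> index_set" "x \<in> ?S" "f_op 1 1 lam1 lam2 i x = Some y" for i x y
    proof -
      obtain a b c d where "x = vec4 a b c d" "(a, b, c, d) \<in> comp_coords lam1 lam2"
        using \<open>x \<in> ?S\<close> by blast
      with that show ?thesis by (blast elim: f_op_vec4)
    qed
  qed
  with assms(3) show ?thesis using that by blast
qed

lemma zero_in_B0: "(\<lambda>_. 0) \<in> B0 c1 c2 lam1 lam2"
  unfolding B0_def by simp

text \<open>
  The element of least coordinate sum in \<open>B\<^sub>0(\<lambda>)\<close> is killed by both \<open>e\<^sub>i\<close>. This replaces an
  explicit chain of operators from the zero sequence to the highest weight vector.
\<close>

lemma ex_highest_in_B0:
  assumes "lam1 > 0" "lam2 < 0"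
  shows "highest_weight_vectors 1 1 lam1 lam2 (B0 1 1 lam1 lam2) \<noteq> {}"
proof -
  \<comment> \<open>the shift makes the sum nonnegative, because \<open>c + d \<le> 2 * c \<le> - 2 * lam2\<close>\<close>
  define rank :: "int \<times> int \<times> int \<times> int \<Rightarrow> nat"
    where "rank = (\<lambda>(a, b, c, d). nat (a + b - c - d - 2 * lam2))"
  let ?P = "\<lambda>(a, b, c, d). (a, b, c, d) \<in> comp_coords lam1 lam2 \<and> vec4 a b c d \<in> B0 1 1 lam1 lam2"
  obtain a0 b0 c0 d0 where "?P (a0, b0, c0, d0)"
    using zero_in_B0 B0_in_comp_coords[OF assms zero_in_B0] by (metis (mono_tags, lifting) case_prod_conv)
  then obtain p where p: "?P p" and least: "\<And>q. ?P q \<Longrightarrow> rank p \<le> rank q"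
    using ex_has_least_nat[of ?P "(a0, b0, c0, d0)" rank] by blast
  obtain a b c d where abcd: "p = (a, b, c, d)" by (cases p)
  have coords: "(a, b, c, d) \<in> comp_coords lam1 lam2" and B0: "vec4 a b c d \<in> B0 1 1 lam1 lam2"
    using p abcd by auto
  have "e_op 1 1 lam1 lam2 i (vec4 a b c d) = None" if i: "i \<in> index_set" for i
  proof (rule ccontr)
    assume "e_op 1 1 lam1 lam2 i (vec4 a b c d) \<noteq> None"
    then obtain y where y: "e_op 1 1 lam1 lam2 i (vec4 a b c d) = Some y" by blast
    then obtain a' b' c' d' where y': "y = vec4 a' b' c' d'" "(a', b', c', d') \<in> comp_coords lam1 lam2"
      and sum: "a' + b' - c' - d' = a + b - c - d - 1"
      using e_op_vec4[OF coords i] by metis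
    have "y \<in> B0 1 1 lam1 lam2"
      using B0_step[OF B0 vec4_Zinf _ i] y y' vec4_Zinf by blast
    then have "rank p \<le> rank (a', b', c', d')" using least[of "(a', b', c', d')"] y' by simp
    moreover have "a' + b' - c' - d' - 2 * lam2 \<ge> 0" using y'(2) by (auto simp: comp_coords_def)
    ultimately show False using sum by (simp add: rank_def abcd)
  qed
  with B0 show ?thesis by (auto simp: highest_weight_vectors_def)
qed

lemma ex_lowest_in_B0:
  assumes "lam1 > 0" "lam2 < 0"
  shows "lowest_weight_vectors 1 1 lam1 lam2 (B0 1 1 lam1 lam2) \<noteq> {}"
proof -
  \<comment> \<open>nonnegative before truncation, because \<open>a + b \<le> 2 * a \<le> 2 * lam1\<close>\<close>
  define rank :: "int \<times> int \<times> int \<times> int \<Rightarrow> nat"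
    where "rank = (\<lambda>(a, b, c, d). nat (2 * lam1 - (a + b - c - d)))"
  let ?P = "\<lambda>(a, b, c, d). (a, b, c, d) \<in> comp_coords lam1 lam2 \<and> vec4 a b c d \<in> B0 1 1 lam1 lam2"
  obtain a0 b0 c0 d0 where "?P (a0, b0, c0, d0)"
    using zero_in_B0 B0_in_comp_coords[OF assms zero_in_B0] by (metis (mono_tags, lifting) case_prod_conv)
  then obtain p where p: "?P p" and least: "\<And>q. ?P q \<Longrightarrow> rank p \<le> rank q"
    using ex_has_least_nat[of ?P "(a0, b0, c0, d0)" rank] by blast
  obtain a b c d where abcd: "p = (a, b, c, d)" by (cases p)
  have coords: "(a, b, c, d) \<in> comp_coords lam1 lam2" and B0: "vec4 a b c d \<in> B0 1 1 lam1 lam2"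
    using p abcd by auto
  have "f_op 1 1 lam1 lam2 i (vec4 a b c d) = None" if i: "i \<in> index_set" for i
  proof (rule ccontr)
    assume "f_op 1 1 lam1 lam2 i (vec4 a b c d) \<noteq> None"
    then obtain y where y: "f_op 1 1 lam1 lam2 i (vec4 a b c d) = Some y" by blast
    then obtain a' b' c' d' where y': "y = vec4 a' b' c' d'" "(a', b', c', d') \<in> comp_coords lam1 lam2"
      and sum: "a' + b' - c' - d' = a + b - c - d + 1"
      using f_op_vec4[OF coords i] by metis
    have "y \<in> B0 1 1 lam1 lam2"
      using B0_step[OF B0 vec4_Zinf _ i] y y' vec4_Zinf by blast
    then have "rank p \<le> rank (a', b', c', d')" using least[of "(a', b', c', d')"] y' by simp
    moreover have "2 * lam1 - (a' + b' - c' - d') \<ge> 0" using y'(2) by (auto simp: comp_coords_def)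
    ultimately show False using sum by (simp add: rank_def abcd)
  qed
  with B0 show ?thesis by (auto simp: lowest_weight_vectors_def)
qed

lemma highest_weight_vectors_B0:
  assumes "lam1 > 0" "lam2 < 0"
  shows "highest_weight_vectors 1 1 lam1 lam2 (B0 1 1 lam1 lam2)
    = {vec4 0 0 (- lam2) (max 0 (- lam1 - lam2))}"
proof -
  have "x = vec4 0 0 (- lam2) (max 0 (- lam1 - lam2))"
    if "x \<in> highest_weight_vectors 1 1 lam1 lam2 (B0 1 1 lam1 lam2)" for x
  proof -
    from that have x: "x \<in> B0 1 1 lam1 lam2" "\<forall>i\<in>index_set. e_op 1 1 lam1 lam2 i x = None"
      by (simp_all add: highest_weight_vectors_def)
    obtain a b c d where "x = vec4 a b c d" "(a, b, c, d) \<in> comp_coords lam1 lam2"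
      using B0_in_comp_coords[OF assms x(1)] .
    with x(2) show ?thesis using highest_vec4 by blast
  qed
  with ex_highest_in_B0[OF assms] show ?thesis by blast
qed

lemma lowest_weight_vectors_B0:
  assumes "lam1 > 0" "lam2 < 0"
  shows "lowest_weight_vectors 1 1 lam1 lam2 (B0 1 1 lam1 lam2)
    = {vec4 lam1 (max 0 (lam1 + lam2)) 0 0}"
proof -
  have "x = vec4 lam1 (max 0 (lam1 + lam2)) 0 0"
    if "x \<in> lowest_weight_vectors 1 1 lam1 lam2 (B0 1 1 lam1 lam2)" for x
  proof -
    from that have x: "x \<in> B0 1 1 lam1 lam2" "\<forall>i\<in>index_set. f_op 1 1 lam1 lam2 i x = None"
      by (simp_all add: lowest_weight_vectors_def)
    obtain a b c d where "x = vec4 a b c d" "(a, b, c, d) \<in> comp_coords lam1 lam2"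
      using B0_in_comp_coords[OF assms x(1)] .
    with x(2) show ?thesis using lowest_vec4 by blast
  qed
  with ex_lowest_in_B0[OF assms] show ?thesis by blast
qed

lemma H_vec_eq_vec4:
  "H_vec lam1 lam2 1 = vec4 0 0 (- lam2) 0"
  "H_vec lam1 lam2 2 = vec4 0 0 (- lam2) (- lam1 - lam2)"
proof -
  show "H_vec lam1 lam2 1 = vec4 0 0 (- lam2) 0"
  proof
    fix k :: int
    consider "k = -1" | "k = -2" | "k \<noteq> -1" "k \<noteq> -2" by blast
    then show "H_vec lam1 lam2 1 k = vec4 0 0 (- lam2) 0 k"
      by cases (auto simp: H_vec_def h_coord_def a_coeff_def vec4_def)
  qed
  show "H_vec lam1 lam2 2 = vec4 0 0 (- lam2) (- lam1 - lam2)"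
  proof
    fix k :: int
    consider "k = -1" | "k = -2" | "k \<noteq> -1" "k \<noteq> -2" by blast
    then show "H_vec lam1 lam2 2 k = vec4 0 0 (- lam2) (- lam1 - lam2) k"
      by cases (auto simp: H_vec_def h_coord_def a_coeff_def vec4_def)
  qed
qed

lemma L_vec_eq_vec4:
  "L_vec lam1 lam2 1 = vec4 lam1 0 0 0"
  "L_vec lam1 lam2 2 = vec4 lam1 (lam1 + lam2) 0 0"
proof -
  show "L_vec lam1 lam2 1 = vec4 lam1 0 0 0"
  proof
    fix k :: int
    consider "k = 1" | "k = 2" | "k \<noteq> 1" "k \<noteq> 2" by blast
    then show "L_vec lam1 lam2 1 k = vec4 lam1 0 0 0 k"
      by cases (auto simp: L_vec_def l_coord_def a_coeff_def vec4_def)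
  qed
  show "L_vec lam1 lam2 2 = vec4 lam1 (lam1 + lam2) 0 0"
  proof
    fix k :: int
    consider "k = 1" | "k = 2" | "k \<noteq> 1" "k \<noteq> 2" by blast
    then show "L_vec lam1 lam2 2 k = vec4 lam1 (lam1 + lam2) 0 0 k"
      by cases (auto simp: L_vec_def l_coord_def a_coeff_def vec4_def)
  qed
qed

theorem mainTheorem6:
  fixes lam1 lam2 :: int
  assumes "lam1 > 0" and "lam2 < 0"
  shows
    "(real_of_int lam1 / (- real_of_int lam2) > 1 \<longrightarrow>
        highest_weight_vectors 1 1 lam1 lam2 (B0 1 1 lam1 lam2) = {H_vec lam1 lam2 1} \<and>
        lowest_weight_vectors 1 1 lam1 lam2 (B0 1 1 lam1 lam2) = {L_vec lam1 lam2 2}) \<and>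
     (real_of_int lam1 / (- real_of_int lam2) = 1 \<longrightarrow>
        highest_weight_vectors 1 1 lam1 lam2 (B0 1 1 lam1 lam2) = {H_vec lam1 lam2 1} \<and>
        lowest_weight_vectors 1 1 lam1 lam2 (B0 1 1 lam1 lam2) = {L_vec lam1 lam2 1}) \<and>
     (1 > real_of_int lam1 / (- real_of_int lam2) \<and> real_of_int lam1 / (- real_of_int lam2) > 0 \<longrightarrow>
        highest_weight_vectors 1 1 lam1 lam2 (B0 1 1 lam1 lam2) = {H_vec lam1 lam2 2} \<and>
        lowest_weight_vectors 1 1 lam1 lam2 (B0 1 1 lam1 lam2) = {L_vec lam1 lam2 1})"
proof -
  have ratio: "real_of_int lam1 / (- real_of_int lam2) > 1 \<longleftrightarrow> lam1 + lam2 > 0"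
    "real_of_int lam1 / (- real_of_int lam2) = 1 \<longleftrightarrow> lam1 + lam2 = 0"
    "1 > real_of_int lam1 / (- real_of_int lam2) \<longleftrightarrow> lam1 + lam2 < 0"
    using assms by (auto simp: field_simps)
  show ?thesis
    unfolding ratio highest_weight_vectors_B0[OF assms] lowest_weight_vectors_B0[OF assms]
      H_vec_eq_vec4 L_vec_eq_vec4
    by (auto simp: max_def vec4_inject)
qed

end
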